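(* Let $\alpha: I\to E^3$ be a Frenet curve with Frenet frame $\{T,N,B\}$ and curvature $\kappa$, and let $\beta$ be a Mannheim-direction curve of $\alpha$ with Frenet frame $\{\overline T,\overline N,\overline B\}$. Then, for a suitable antiderivative $\int\kappa\,ds$ of $\kappa$, $$\overline T(s)=\sin\left(\int\kappa\,ds\right)T(s)+\cos\left(\int\kappa\,ds\right)N(s),\qquad \overline N(s)=B(s),$$ $$\overline B(s)=\cos\left(\int\kappa\,ds\right)T(s)-\sin\left(\int\kappa\,ds\right)N(s).$$
   Context: $I\subset\mathbb{R}$ is an open interval and curves are smooth. A unit speed curve $\alpha:I\to E^3$ is a Frenet curve if its curvature $\kappa=\|\alpha''\|$ is nowhere zero; then $T=\alpha'$, $N=\alpha''/\kappa$, $B=T\times N$, and $T'=\kappa N$, $N'=-\kappa T+\tau B$, $B'=-\tau N$, where $\tau$ is the torsion. For a unit vector field $X(s)=a(s)T(s)+b(s)N(s)+c(s)B(s)$ with $a,b,c$ smooth and $a^2+b^2+c^2=1$, an $X$-direction curve of $\alpha$ is a curve $\beta:I\to E^3$ with $\beta'(s)=X(s)$; the parameter $s$ is then also arc length for $\beta$. The Frenet vectors of $\beta$ are defined in the same way ($\overline T=\beta'$, $\overline\kappa=\|\beta''\|$, $\overline N=\beta''/\overline\kappa$, $\overline B=\overline T\times\overline N$). An $X$-direction curve $\beta$ of $\alpha$ (for some such $X$) is called a Mannheim-direction curve of $\alpha$ if $\beta$ is a Mannheim curve of $\alpha$ (and $\alpha$ a Mannheim partner curve of $\beta$), in the sense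 that $\beta$ is a Frenet curve with $\overline N=B$ at each common parameter value $s$. *)

theory Defs
  imports "HOL-Analysis.Analysis"
begin

definition vderiv :: "(real \<Rightarrow> 'a::real_normed_vector) \<Rightarrow> real \<Rightarrow> 'a" where
  "vderiv f = (\<lambda>t. vector_derivative f (at t))"

text \<open>\<^const>\<open>vector_derivative\<close> has an unspecified value where no derivative exists, so
  differentiability is demanded at every order. On an open set \<open>I\<close>, \<^term>\<open>(vderiv ^^ n) f\<close>
  restricted to \<open>I\<close> depends only on the values of \<open>f\<close> on \<open>I\<close>.\<close>

definition smooth_on :: "real set \<Rightarrow> (real \<Rightarrow> 'a::real_normed_vector) \<Rightarrow> bool" where
  "smooth_on I f \<longleftrightarrow> (\<forall>n. \<forall>t\<in>I. ((vderiv ^^ n) f) differentiable (at t))"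

definition open_interval :: "real set \<Rightarrow> bool" where
  "open_interval I \<longleftrightarrow> open I \<and> is_interval I \<and> I \<noteq> {}"

definition unit_speed_on :: "real set \<Rightarrow> (real \<Rightarrow> real ^ 3) \<Rightarrow> bool" where
  "unit_speed_on I \<alpha> \<longleftrightarrow> (\<forall>s\<in>I. norm (vderiv \<alpha> s) = 1)"

text \<open>The curvature and the frame vectors below have their geometric meaning for unit speed
  curves only.\<close>

definition curvature :: "(real \<Rightarrow> real ^ 3) \<Rightarrow> real \<Rightarrow> real" where
  "curvature \<alpha> s = norm (vderiv (vderiv \<alpha>) s)"

definition frenet_curve :: "real set \<Rightarrow> (real \<Rightarrow> real ^ 3) \<Rightarrow> bool" where
  "frenet_curve I \<alpha> \<longleftrightarrow>
     smooth_on I \<alpha> \<and> unit_speed_on I \<alpha> \<and> (\<forall>s\<in>I. curvature \<alpha> s \<noteq> 0)"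

definition frenet_T :: "(real \<Rightarrow> real ^ 3) \<Rightarrow> real \<Rightarrow> real ^ 3" where
  "frenet_T \<alpha> s = vderiv \<alpha> s"

definition frenet_N :: "(real \<Rightarrow> real ^ 3) \<Rightarrow> real \<Rightarrow> real ^ 3" where
  "frenet_N \<alpha> s = vderiv (vderiv \<alpha>) s /\<^sub>R curvature \<alpha> s"

definition frenet_B :: "(real \<Rightarrow> real ^ 3) \<Rightarrow> real \<Rightarrow> real ^ 3" where
  "frenet_B \<alpha> s = cross3 (frenet_T \<alpha> s) (frenet_N \<alpha> s)"

definition unit_field_along ::
    "real set \<Rightarrow> (real \<Rightarrow> real ^ 3) \<Rightarrow> (real \<Rightarrow> real ^ 3) \<Rightarrow> bool" where
  "unit_field_along I \<alpha> X \<longleftrightarrow>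
     (\<exists>a b c :: real \<Rightarrow> real. smooth_on I a \<and> smooth_on I b \<and> smooth_on I c \<and>
        (\<forall>s\<in>I. (a s)\<^sup>2 + (b s)\<^sup>2 + (c s)\<^sup>2 = 1 \<and>
               X s = a s *\<^sub>R frenet_T \<alpha> s + b s *\<^sub>R frenet_N \<alpha> s + c s *\<^sub>R frenet_B \<alpha> s))"

definition direction_curve ::
    "real set \<Rightarrow> (real \<Rightarrow> real ^ 3) \<Rightarrow> (real \<Rightarrow> real ^ 3) \<Rightarrow> (real \<Rightarrow> real ^ 3) \<Rightarrow> bool" where
  "direction_curve I X \<alpha> \<beta> \<longleftrightarrow>
     unit_field_along I \<alpha> X \<and> smooth_on I \<beta> \<and> (\<forall>s\<in>I. (\<beta> has_vector_derivative X s) (at s))"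

text \<open>\<open>mannheim_curve I \<alpha> \<beta>\<close>: \<open>\<beta>\<close> is a Mannheim curve of \<open>\<alpha>\<close>, and \<open>\<alpha>\<close> a Mannheim partner curve
  of \<open>\<beta>\<close>. The condition is equality of vectors at equal parameter values, not just
  parallelism of the corresponding lines.\<close>

definition mannheim_curve ::
    "real set \<Rightarrow> (real \<Rightarrow> real ^ 3) \<Rightarrow> (real \<Rightarrow> real ^ 3) \<Rightarrow> bool" where
  "mannheim_curve I \<alpha> \<beta> \<longleftrightarrow>
     frenet_curve I \<alpha> \<and> frenet_curve I \<beta> \<and> (\<forall>s\<in>I. frenet_N \<beta> s = frenet_B \<alpha> s)"

definition mannheim_direction_curve ::
    "real set \<Rightarrow> (real \<Rightarrow> real ^ 3) \<Rightarrow> (real \<Rightarrow> real ^ 3) \<Rightarrow> bool" where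
  "mannheim_direction_curve I \<alpha> \<beta> \<longleftrightarrow>
     (\<exists>X. direction_curve I X \<alpha> \<beta>) \<and> mannheim_curve I \<alpha> \<beta>"

end

theory Submission imports Defs begin

text \<open>
  Write \<open>\<kappa>\<close> for the curvature of \<open>\<alpha>\<close> and expand the unit tangent \<open>U\<close> of \<open>\<beta>\<close> in the Frenet
  frame of \<open>\<alpha>\<close>. The derivative of \<open>U\<close> is a multiple of the principal normal of \<open>\<beta>\<close>, that is, of
  \<open>B\<close>. This has two consequences. A unit vector field is orthogonal to its derivative, so \<open>U\<close> is
  orthogonal to \<open>B\<close> and \<open>U = a T + b N\<close>. And since \<open>U'\<close> is orthogonal to \<open>T\<close> and \<open>N\<close>, only the
  motion of the frame contributes to the derivatives of \<open>a = U \<bullet> T\<close> and \<open>b = U \<bullet> N\<close>, whence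
  \<open>a' = \<kappa> b\<close> and \<open>b' = - \<kappa> a\<close>; the torsion drops out, because it enters only through the component
  of \<open>N'\<close> along \<open>B\<close>.

  So \<open>(b, a)\<close> is a point of the unit circle that rotates with angular velocity \<open>\<kappa>\<close>. Its polar
  angle \<open>\<theta>\<close> is an antiderivative of \<open>\<kappa>\<close>, with \<open>a = sin \<theta>\<close> and \<open>b = cos \<theta>\<close>
  (\<open>unit_rotation_polar_angle\<close>). Finally \<open>U \<times> B = b T - a N\<close> gives the binormal of \<open>\<beta>\<close>.
\<close>

section \<open>Antiderivatives and rotation on an open interval\<close>

text \<open>The antiderivatives of the library live on intervals given by their endpoints, possibly
  infinite; the endpoints of \<open>I\<close> are its infimum and supremum as a set of extended reals.\<close>

lemma open_interval_eq_einterval: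
  assumes "open_interval I"
  obtains a b where "a < b" "I = einterval a b"
proof
  let ?a = "INF x\<in>I. ereal x" and ?b = "SUP x\<in>I. ereal x"
  have I: "open I" "is_interval I" "I \<noteq> {}"
    using assms by (auto simp: open_interval_def)
  have inside: "?a < ereal x \<and> ereal x < ?b" if "x \<in> I" for x
  proof -
    obtain e where e: "e > 0" "cball x e \<subseteq> I"
      using I(1) \<open>x \<in> I\<close> open_contains_cball by blast
    then have "x - e \<in> I" "x + e \<in> I"
      by (auto simp: dist_real_def subset_iff)
    then have "?a \<le> ereal (x - e)" "ereal (x + e) \<le> ?b"
      by (auto intro: INF_lower SUP_upper)
    moreover have "ereal (x - e) < ereal x" "ereal x < ereal (x + e)"
      using e by auto
    ultimately show ?thesis
      using order.strict_trans1 order.strict_trans2 by blast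
  qed
  then show "?a < ?b"
    using I(3) by (fast intro: less_trans)
  have "x \<in> I" if x: "?a < ereal x" "ereal x < ?b" for x
  proof -
    obtain y z where "y \<in> I" "y < x" "z \<in> I" "x < z"
      using x unfolding INF_less_iff less_SUP_iff less_ereal.simps by blast
    then show ?thesis
      using I(2) unfolding is_interval_1 by (blast intro: less_imp_le)
  qed
  with inside show "I = einterval ?a ?b"
    unfolding set_eq_iff einterval_iff by blast
qed

lemma antiderivative_on_open_interval:
  fixes f :: "real \<Rightarrow> real"
  assumes "open_interval I" "\<And>s. s \<in> I \<Longrightarrow> isCont f s"
  obtains F where "\<And>s. s \<in> I \<Longrightarrow> (F has_real_derivative f s) (at s)"
proof -
  obtain a b where ab: "a < b" "I = einterval a b"
    using open_interval_eq_einterval[OF assms(1)] by blast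
  have "\<exists>F. \<forall>x. a < ereal x \<longrightarrow> ereal x < b \<longrightarrow> (F has_vector_derivative f x) (at x)"
    using assms(2) ab by (intro einterval_antiderivative) (auto simp: einterval_iff)
  then show ?thesis
    using that ab(2) by (auto simp: einterval_iff has_real_derivative_iff_has_vector_derivative)
qed

text \<open>The polar angle comes without any choice of branch: turning \<open>(b, a)\<close> back by an
  antiderivative \<open>F\<close> of \<open>k\<close> stops its motion, and the polar angle of the point at which it then
  rests is the constant that has to be added to \<open>F\<close>.\<close>

lemma unit_rotation_polar_angle:
  fixes a b k :: "real \<Rightarrow> real"
  assumes I: "open_interval I"
    and k: "\<And>s. s \<in> I \<Longrightarrow> isCont k s"
    and a: "\<And>s. s \<in> I \<Longrightarrow> (a has_real_derivative k s * b s) (at s)"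
    and b: "\<And>s. s \<in> I \<Longrightarrow> (b has_real_derivative - (k s * a s)) (at s)"
    and unit: "\<And>s. s \<in> I \<Longrightarrow> (a s)\<^sup>2 + (b s)\<^sup>2 = 1"
  obtains \<theta> where "\<And>s. s \<in> I \<Longrightarrow> (\<theta> has_real_derivative k s) (at s)"
    and "\<And>s. s \<in> I \<Longrightarrow> a s = sin (\<theta> s)" "\<And>s. s \<in> I \<Longrightarrow> b s = cos (\<theta> s)"
proof -
  obtain F where F: "\<And>s. s \<in> I \<Longrightarrow> (F has_real_derivative k s) (at s)"
    using antiderivative_on_open_interval[OF I k] by blast
  define p where "p s = b s * cos (F s) + a s * sin (F s)" for s
  define q where "q s = a s * cos (F s) - b s * sin (F s)" for s
  have conv: "convex I"
    using I by (simp add: open_interval_def is_interval_convex_1)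
  have "(p has_real_derivative 0) (at s within I)" if "s \<in> I" for s
    unfolding p_def
    by (rule DERIV_subset[where s=UNIV])
      (auto intro!: derivative_eq_intros a[OF that] b[OF that] F[OF that] simp: algebra_simps)
  then obtain p0 where p0: "\<And>s. s \<in> I \<Longrightarrow> p s = p0"
    using has_field_derivative_zero_constant[OF conv] by metis
  have "(q has_real_derivative 0) (at s within I)" if "s \<in> I" for s
    unfolding q_def
    by (rule DERIV_subset[where s=UNIV])
      (auto intro!: derivative_eq_intros a[OF that] b[OF that] F[OF that] simp: algebra_simps)
  then obtain q0 where q0: "\<And>s. s \<in> I \<Longrightarrow> q s = q0"
    using has_field_derivative_zero_constant[OF conv] by metis
  have norm: "(p s)\<^sup>2 + (q s)\<^sup>2 = ((a s)\<^sup>2 + (b s)\<^sup>2) * ((sin (F s))\<^sup>2 + (cos (F s))\<^sup>2)" for s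
    unfolding p_def q_def by algebra
  obtain s0 where "s0 \<in> I"
    using I by (auto simp: open_interval_def)
  then have "p0\<^sup>2 + q0\<^sup>2 = 1"
    using norm[of s0] p0 q0 unit by simp
  then obtain d where d: "p0 = cos d" "q0 = sin d"
    using sincos_total_2pi by metis
  have turn_back: "a s = q s * cos (F s) + p s * sin (F s)"
      "b s = p s * cos (F s) - q s * sin (F s)" for s
    using sin_cos_squared_add[of "F s"] unfolding p_def q_def by algebra+
  show ?thesis
  proof
    show "((\<lambda>s. F s + d) has_real_derivative k s) (at s)" if "s \<in> I" for s
      using F[OF that] by (auto intro!: derivative_eq_intros)
    show "a s = sin (F s + d)" "b s = cos (F s + d)" if "s \<in> I" for s
      using turn_back[of s] p0[OF that] q0[OF that] d
      by (simp_all add: sin_add cos_add mult.commute)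
  qed
qed

section \<open>The moving frame of a Frenet curve\<close>

lemma constant_inner_derivative:
  fixes f g :: "real \<Rightarrow> 'a::real_inner"
  assumes "open I" "s \<in> I" "\<And>t. t \<in> I \<Longrightarrow> f t \<bullet> g t = c"
    and "(f has_vector_derivative f') (at s)" "(g has_vector_derivative g') (at s)"
  shows "f' \<bullet> g s + f s \<bullet> g' = 0"
proof -
  have "((\<lambda>t. f t \<bullet> g t) has_vector_derivative (f s \<bullet> g' + f' \<bullet> g s)) (at s)"
    using bounded_bilinear.has_vector_derivative[OF bounded_bilinear_inner assms(4,5)] .
  moreover have "((\<lambda>t. f t \<bullet> g t) has_vector_derivative 0) (at s)"
    by (rule has_vector_derivative_transform_within_open[OF has_vector_derivative_const assms(1,2)])
      (simp add: assms(3))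
  ultimately show ?thesis
    using vector_derivative_unique_at by fastforce
qed

lemma frenet_curve_derivatives:
  assumes "frenet_curve I \<alpha>" "s \<in> I"
  shows "(frenet_T \<alpha> has_vector_derivative curvature \<alpha> s *\<^sub>R frenet_N \<alpha> s) (at s)"
    and "isCont (curvature \<alpha>) s"
    and "frenet_N \<alpha> differentiable (at s)"
proof -
  have smooth: "smooth_on I \<alpha>" and nz: "curvature \<alpha> s \<noteq> 0"
    using assms by (auto simp: frenet_curve_def)
  have "((vderiv ^^ 1) \<alpha>) differentiable (at s)" and "((vderiv ^^ 2) \<alpha>) differentiable (at s)"
    using smooth assms(2) unfolding smooth_on_def by blast+
  then have d1: "vderiv \<alpha> differentiable (at s)"
    and d2: "vderiv (vderiv \<alpha>) differentiable (at s)"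
    by (simp_all add: numeral_2_eq_2)
  have T: "frenet_T \<alpha> = vderiv \<alpha>"
    by (simp add: fun_eq_iff frenet_T_def)
  show "(frenet_T \<alpha> has_vector_derivative curvature \<alpha> s *\<^sub>R frenet_N \<alpha> s) (at s)"
    using d1 nz by (simp add: T frenet_N_def vector_derivative_works vderiv_def)
  have \<kappa>: "curvature \<alpha> = (\<lambda>s. norm (vderiv (vderiv \<alpha>) s))"
    by (simp add: fun_eq_iff curvature_def)
  show "isCont (curvature \<alpha>) s"
    unfolding \<kappa> using differentiable_imp_continuous_within[OF d2] by (rule continuous_norm)
  have "(norm \<circ> vderiv (vderiv \<alpha>)) differentiable (at s)"
    using nz by (intro differentiable_chain_at d2 differentiable_norm_at) (simp add: curvature_def)
  then have "curvature \<alpha> differentiable (at s)"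
    by (simp add: \<kappa> o_def)
  then have "(\<lambda>s. inverse (curvature \<alpha> s) *\<^sub>R vderiv (vderiv \<alpha>) s) differentiable (at s)"
    using nz d2 by (intro differentiable_scaleR differentiable_inverse)
  moreover have "frenet_N \<alpha> = (\<lambda>s. inverse (curvature \<alpha> s) *\<^sub>R vderiv (vderiv \<alpha>) s)"
    by (simp add: fun_eq_iff frenet_N_def)
  ultimately show "frenet_N \<alpha> differentiable (at s)"
    by simp
qed

lemma frenet_frame_orthonormal:
  assumes "frenet_curve I \<alpha>" "open I" "s \<in> I"
  shows "frenet_T \<alpha> s \<bullet> frenet_T \<alpha> s = 1" "frenet_N \<alpha> s \<bullet> frenet_N \<alpha> s = 1"
    and "frenet_T \<alpha> s \<bullet> frenet_N \<alpha> s = 0"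
    and "frenet_T \<alpha> s \<bullet> frenet_B \<alpha> s = 0" "frenet_N \<alpha> s \<bullet> frenet_B \<alpha> s = 0"
    and "frenet_B \<alpha> s \<bullet> frenet_B \<alpha> s = 1"
proof -
  have nz: "curvature \<alpha> s \<noteq> 0"
    using assms by (auto simp: frenet_curve_def)
  have TT: "frenet_T \<alpha> t \<bullet> frenet_T \<alpha> t = 1" if "t \<in> I" for t
    using assms(1) that
    by (simp add: frenet_curve_def unit_speed_on_def frenet_T_def dot_square_norm)
  show TT_s: "frenet_T \<alpha> s \<bullet> frenet_T \<alpha> s = 1"
    using TT assms(3) .
  have "norm (frenet_N \<alpha> s) = 1"
    using nz by (simp add: frenet_N_def curvature_def)
  then show NN: "frenet_N \<alpha> s \<bullet> frenet_N \<alpha> s = 1"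
    by (simp add: dot_square_norm)
  have "2 * (curvature \<alpha> s * (frenet_T \<alpha> s \<bullet> frenet_N \<alpha> s)) = 0"
    using constant_inner_derivative[OF assms(2,3) TT
        frenet_curve_derivatives(1)[OF assms(1,3)] frenet_curve_derivatives(1)[OF assms(1,3)]]
    by (simp add: inner_commute)
  then show TN: "frenet_T \<alpha> s \<bullet> frenet_N \<alpha> s = 0"
    using nz by simp
  show "frenet_T \<alpha> s \<bullet> frenet_B \<alpha> s = 0" "frenet_N \<alpha> s \<bullet> frenet_B \<alpha> s = 0"
    by (simp_all add: frenet_B_def dot_cross_self)
  show "frenet_B \<alpha> s \<bullet> frenet_B \<alpha> s = 1"
    using TT_s NN TN by (simp add: frenet_B_def dot_cross inner_commute)
qed

text \<open>The components of \<open>N' = - \<kappa> T + \<tau> B\<close> in the osculating plane come from differentiating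
  \<open>T \<bullet> N = 0\<close> and \<open>N \<bullet> N = 1\<close>.\<close>

lemma frenet_N_derivative_components:
  assumes "frenet_curve I \<alpha>" "open I" "s \<in> I"
  obtains N' where "(frenet_N \<alpha> has_vector_derivative N') (at s)"
    and "frenet_T \<alpha> s \<bullet> N' = - curvature \<alpha> s" "frenet_N \<alpha> s \<bullet> N' = 0"
proof
  let ?N' = "vector_derivative (frenet_N \<alpha>) (at s)"
  show N': "(frenet_N \<alpha> has_vector_derivative ?N') (at s)"
    using frenet_curve_derivatives(3)[OF assms(1,3)] by (simp add: vector_derivative_works)
  note frame = frenet_frame_orthonormal[OF assms(1,2)]
  show "frenet_T \<alpha> s \<bullet> ?N' = - curvature \<alpha> s"
    using constant_inner_derivative[OF assms(2,3) frame(3)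
        frenet_curve_derivatives(1)[OF assms(1,3)] N'] frame(2)[OF assms(3)]
    by simp
  show "frenet_N \<alpha> s \<bullet> ?N' = 0"
    using constant_inner_derivative[OF assms(2,3) frame(2) N' N'] by (simp add: inner_commute)
qed

section \<open>The frame of a Mannheim-direction curve\<close>

theorem corollary4p4:
  fixes I :: "real set" and \<alpha> \<beta> :: "real \<Rightarrow> real ^ 3"
  assumes "open_interval I"
    and "frenet_curve I \<alpha>"
    and "mannheim_direction_curve I \<alpha> \<beta>"
  shows "\<exists>\<theta> :: real \<Rightarrow> real.
           (\<forall>s\<in>I. (\<theta> has_real_derivative curvature \<alpha> s) (at s)) \<and>
           (\<forall>s\<in>I.
              frenet_T \<beta> s = sin (\<theta> s) *\<^sub>R frenet_T \<alpha> s + cos (\<theta> s) *\<^sub>R frenet_N \<alpha> s \<and>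
              frenet_N \<beta> s = frenet_B \<alpha> s \<and>
              frenet_B \<beta> s = cos (\<theta> s) *\<^sub>R frenet_T \<alpha> s - sin (\<theta> s) *\<^sub>R frenet_N \<alpha> s)"
proof -
  have "open I"
    using assms(1) by (simp add: open_interval_def)
  obtain X where X: "unit_field_along I \<alpha> X"
      "\<And>s. s \<in> I \<Longrightarrow> (\<beta> has_vector_derivative X s) (at s)"
    and \<beta>: "frenet_curve I \<beta>" and NB: "\<And>s. s \<in> I \<Longrightarrow> frenet_N \<beta> s = frenet_B \<alpha> s"
    using assms(3)
    by (auto simp: mannheim_direction_curve_def mannheim_curve_def direction_curve_def)
  obtain a b c :: "real \<Rightarrow> real" where abc:
    "\<And>s. s \<in> I \<Longrightarrow> X s = a s *\<^sub>R frenet_T \<alpha> s + b s *\<^sub>R frenet_N \<alpha> s + c s *\<^sub>R frenet_B \<alpha> s"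
    using X(1) unfolding unit_field_along_def by blast
  note frame = frenet_frame_orthonormal[OF assms(2) \<open>open I\<close>]
  note frame\<beta> = frenet_frame_orthonormal[OF \<beta> \<open>open I\<close>]
  have U: "frenet_T \<beta> s = (frenet_T \<beta> s \<bullet> frenet_T \<alpha> s) *\<^sub>R frenet_T \<alpha> s +
      (frenet_T \<beta> s \<bullet> frenet_N \<alpha> s) *\<^sub>R frenet_N \<alpha> s" (is "_ = ?U s") if s: "s \<in> I" for s
  proof -
    have eq: "frenet_T \<beta> s = a s *\<^sub>R frenet_T \<alpha> s + b s *\<^sub>R frenet_N \<alpha> s + c s *\<^sub>R frenet_B \<alpha> s"
      using vector_derivative_at[OF X(2)[OF s]] abc[OF s] by (simp add: frenet_T_def vderiv_def)
    have "frenet_T \<beta> s \<bullet> frenet_B \<alpha> s = 0"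
      using frame\<beta>(3)[OF s] NB[OF s] by simp
    then have "c s = 0"
      using frame[OF s] by (simp add: eq inner_add_left)
    then show ?thesis
      using frame[OF s] by (simp add: eq inner_add_left inner_add_right inner_commute)
  qed
  have U': "(frenet_T \<beta> has_vector_derivative curvature \<beta> s *\<^sub>R frenet_B \<alpha> s) (at s)"
    if s: "s \<in> I" for s
    using frenet_curve_derivatives(1)[OF \<beta> s] NB[OF s] by simp
  obtain \<theta> where \<theta>: "\<And>s. s \<in> I \<Longrightarrow> (\<theta> has_real_derivative curvature \<alpha> s) (at s)"
      "\<And>s. s \<in> I \<Longrightarrow> frenet_T \<beta> s \<bullet> frenet_T \<alpha> s = sin (\<theta> s)"
      "\<And>s. s \<in> I \<Longrightarrow> frenet_T \<beta> s \<bullet> frenet_N \<alpha> s = cos (\<theta> s)"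
  proof (rule unit_rotation_polar_angle[OF assms(1), of "curvature \<alpha>"
        "\<lambda>s. frenet_T \<beta> s \<bullet> frenet_T \<alpha> s" "\<lambda>s. frenet_T \<beta> s \<bullet> frenet_N \<alpha> s"])
    fix s assume s: "s \<in> I"
    show "isCont (curvature \<alpha>) s"
      using frenet_curve_derivatives(2)[OF assms(2) s] .
    show "((\<lambda>s. frenet_T \<beta> s \<bullet> frenet_T \<alpha> s) has_real_derivative
        curvature \<alpha> s * (frenet_T \<beta> s \<bullet> frenet_N \<alpha> s)) (at s)"
      using bounded_bilinear.has_vector_derivative[OF bounded_bilinear_inner U'[OF s]
          frenet_curve_derivatives(1)[OF assms(2) s]] frame[OF s]
      by (simp add: has_real_derivative_iff_has_vector_derivative inner_commute)
    obtain N' where N': "(frenet_N \<alpha> has_vector_derivative N') (at s)"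
      and N'_TN: "frenet_T \<alpha> s \<bullet> N' = - curvature \<alpha> s" "frenet_N \<alpha> s \<bullet> N' = 0"
      using frenet_N_derivative_components[OF assms(2) \<open>open I\<close> s] by blast
    \<comment> \<open>The component of \<open>N'\<close> along \<open>B\<close> is invisible here, as \<open>U\<close> lies in the plane of \<open>T\<close> and \<open>N\<close>.\<close>
    have "frenet_T \<beta> s \<bullet> N' = ?U s \<bullet> N'"
      using U[OF s] by simp
    also have "\<dots> = - (curvature \<alpha> s * (frenet_T \<beta> s \<bullet> frenet_T \<alpha> s))"
      by (simp add: inner_add_left N'_TN)
    finally show "((\<lambda>s. frenet_T \<beta> s \<bullet> frenet_N \<alpha> s) has_real_derivative
        - (curvature \<alpha> s * (frenet_T \<beta> s \<bullet> frenet_T \<alpha> s))) (at s)"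
      using bounded_bilinear.has_vector_derivative[OF bounded_bilinear_inner U'[OF s] N'] frame[OF s]
      by (simp add: has_real_derivative_iff_has_vector_derivative inner_commute)
    have "1 = frenet_T \<beta> s \<bullet> ?U s"
      using U[OF s] frame\<beta>(1)[OF s] by simp
    then show "(frenet_T \<beta> s \<bullet> frenet_T \<alpha> s)\<^sup>2 + (frenet_T \<beta> s \<bullet> frenet_N \<alpha> s)\<^sup>2 = 1"
      by (simp add: inner_add_right power2_eq_square)
  qed blast
  have "frenet_T \<beta> s = sin (\<theta> s) *\<^sub>R frenet_T \<alpha> s + cos (\<theta> s) *\<^sub>R frenet_N \<alpha> s \<and>
      frenet_N \<beta> s = frenet_B \<alpha> s \<and>
      frenet_B \<beta> s = cos (\<theta> s) *\<^sub>R frenet_T \<alpha> s - sin (\<theta> s) *\<^sub>R frenet_N \<alpha> s" if s: "s \<in> I" for s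
  proof -
    have "frenet_B \<beta> s = cross3 (frenet_T \<beta> s) (cross3 (frenet_T \<alpha> s) (frenet_N \<alpha> s))"
      using NB[OF s] by (simp add: frenet_B_def)
    also have "\<dots> = (frenet_T \<beta> s \<bullet> frenet_N \<alpha> s) *\<^sub>R frenet_T \<alpha> s -
        (frenet_T \<beta> s \<bullet> frenet_T \<alpha> s) *\<^sub>R frenet_N \<alpha> s"
      by (rule Lagrange)
    finally show ?thesis
      using U[OF s] NB[OF s] \<theta>(2,3)[OF s] by simp
  qed
  with \<theta>(1) show ?thesis by blast
qed

end
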